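(* Let $\mathcal{A}$ be a commutative unital locally $C^{\ast}$-algebra whose topology is given by the upward filtered family $\{p_\alpha\}_{\alpha\in\Lambda}$ of $C^{\ast}$-seminorms, and let the character space $\mathcal{M}_{\mathcal{A}}$ be equipped with the topology $\tau$ defined in the context. Then $\left(\mathcal{M}_{\mathcal{A}},\{\gamma_\alpha\}_{\alpha\in\Lambda}\right)$ is the inductive limit of the inductive system $\left(\{\mathcal{M}_{\mathcal{A}_\alpha}\}_{\alpha\in\Lambda},\{\gamma_{\beta,\alpha}\}_{\alpha\le\beta}\right)$ of compact Hausdorff spaces, i.e. $\mathcal{M}_{\mathcal{A}}=\varinjlim_{\alpha\in\Lambda}\mathcal{M}_{\mathcal{A}_\alpha}$.
   Context: A $C^{\ast}$-seminorm on a unital complex $\ast$-algebra $\mathcal{A}$ is a seminorm $p$ with $p(1)=1$, $p(ab)\le p(a)p(b)$, $p(a^{\ast})=p(a)$, $p(a^{\ast}a)=p(a)^2$. Let $(\Lambda,\le)$ be a directed partially ordered set. A family $\{p_\alpha\}_{\alpha\in\Lambda}$ is upward filtered if $p_\alpha(a)\le p_\beta(a)$ for all $a$ whenever $\alpha\le\beta$. $\mathcal{A}$ is a (unital) locally $C^{\ast}$-algebra if it has a complete Hausdorff locally convex topology induced by an upward filtered family $\{p_\alpha\}_{\alpha\in\Lambda}$ of $C^{\ast}$-seminorms. Put $\mathcal{I}_\alpha=\{a\in\mathcal{A}: p_\alpha(a)=0\}$, $\mathcal{A}_\alpha=\mathcal{A}/\mathcal{I}_\alpha$ (a $C^{\ast}$-algebra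 with norm $\|a+\mathcal{I}_\alpha\|=p_\alpha(a)$), $\pi_\alpha:\mathcal{A}\to\mathcal{A}_\alpha$ the quotient map, and for $\alpha\le\beta$ let $\pi_{\alpha,\beta}:\mathcal{A}_\beta\to\mathcal{A}_\alpha$, $a+\mathcal{I}_\beta\mapsto a+\mathcal{I}_\alpha$. $\mathcal{M}_{\mathcal{A}_\alpha}$ is the set of nonzero multiplicative linear functionals on $\mathcal{A}_\alpha$ with the weak$^{\ast}$-topology (compact Hausdorff). The character space is $\mathcal{M}_{\mathcal{A}}=\{\varphi_\alpha\circ\pi_\alpha:\alpha\in\Lambda,\ \varphi_\alpha\in\mathcal{M}_{\mathcal{A}_\alpha}\}$. Put $\mathcal{Z}_\alpha=\{\varphi_\alpha\circ\pi_\alpha:\varphi_\alpha\in\mathcal{M}_{\mathcal{A}_\alpha}\}$, whose open sets are the sets $\{\varphi_\alpha\circ\pi_\alpha:\varphi_\alpha\in\mathcal{O}\}$ with $\mathcal{O}$ open in $\mathcal{M}_{\mathcal{A}_\alpha}$; then $\mathcal{M}_{\mathcal{A}}=\bigcup_\alpha\mathcal{Z}_\alpha$. The topology is $\tau=\{S\subseteq\mathcal{M}_{\mathcal{A}}: S\cap\mathcal{Z}_\alpha\text{ is open in }\mathcal{Z}_\alpha\text{ for all }\alpha\in\Lambda\}$. For $\alpha\le\beta$, $\gamma_{\beta,\alpha}:\mathcal{M}_{\mathcal{A}_\alpha}\to\mathcal{M}_{\mathcal{A}_\beta}$ is $\gamma_{\beta,\alpha}(\varphi)=\varphi\circ\pi_{\alpha,\beta}$,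 and $\gamma_\alpha:\mathcal{M}_{\mathcal{A}_\alpha}\to\mathcal{M}_{\mathcal{A}}$ is $\gamma_\alpha(\varphi)=\varphi\circ\pi_\alpha$. An inductive system of topological spaces is a family $\{X_\alpha\}_{\alpha\in\Lambda}$ with continuous maps $\psi_{\beta,\alpha}:X_\alpha\to X_\beta$ ($\alpha\le\beta$), $\psi_{\alpha,\alpha}=\mathrm{id}$, $\psi_{\delta,\beta}\circ\psi_{\beta,\alpha}=\psi_{\delta,\alpha}$ for $\alpha\le\beta\le\delta$. A pair $(Y,\{\kappa_\alpha\})$ of a topological space and continuous maps $\kappa_\alpha:X_\alpha\to Y$ is compatible if $\kappa_\beta\circ\psi_{\beta,\alpha}=\kappa_\alpha$ for $\alpha\le\beta$. An inductive limit is a compatible pair $(X,\{\psi_\alpha\})$ such that for every compatible $(Y,\{\kappa_\alpha\})$ there is a unique continuous $\kappa:X\to Y$ with $\kappa\circ\psi_\alpha=\kappa_\alpha$ for all $\alpha$. *)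

theory Defs
  imports "HOL-Analysis.Analysis"
begin

section \<open>Locally C*-algebras\<close>

locale complex_star_algebra = vector_space cscale
  for cscale :: "complex \<Rightarrow> 'a::ring_1 \<Rightarrow> 'a" +
  fixes star :: "'a \<Rightarrow> 'a"
  assumes cscale_mult_left: "cscale c x * y = cscale c (x * y)"
    and cscale_mult_right: "x * cscale c y = cscale c (x * y)"
    and star_add: "star (x + y) = star x + star y"
    and star_cscale: "star (cscale c x) = cscale (cnj c) (star x)"
    and star_mult: "star (x * y) = star y * star x"
    and star_star: "star (star x) = x"

definition seminorm :: "(complex \<Rightarrow> 'a::ab_group_add \<Rightarrow> 'a) \<Rightarrow> ('a \<Rightarrow> real) \<Rightarrow> bool" where
  "seminorm cscale q \<longleftrightarrow>
     (\<forall>x. 0 \<le> q x) \<and> (\<forall>x y. q (x + y) \<le> q x + q y) \<and> (\<forall>c x. q (cscale c x) = cmod c * q x)"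

definition cstar_seminorm ::
  "(complex \<Rightarrow> 'a::ring_1 \<Rightarrow> 'a) \<Rightarrow> ('a \<Rightarrow> 'a) \<Rightarrow> ('a \<Rightarrow> real) \<Rightarrow> bool" where
  "cstar_seminorm cscale star q \<longleftrightarrow>
     seminorm cscale q \<and> q 1 = 1 \<and> (\<forall>x y. q (x * y) \<le> q x * q y) \<and>
     (\<forall>x. q (star x) = q x) \<and> (\<forall>x. q (star x * x) = (q x)\<^sup>2)"

definition seminorm_topology :: "('i \<Rightarrow> 'a::ab_group_add \<Rightarrow> real) \<Rightarrow> 'a topology" where
  "seminorm_topology p =
     topology_generated_by {{x. p \<alpha> (x - a) < \<epsilon>} | \<alpha> a \<epsilon>. \<epsilon> > 0}"

definition seminorm_cauchy_filter ::
  "('i \<Rightarrow> 'a::ab_group_add \<Rightarrow> real) \<Rightarrow> 'a filter \<Rightarrow> bool" where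
  "seminorm_cauchy_filter p F \<longleftrightarrow>
     (\<forall>\<alpha>. \<forall>\<epsilon>>0. \<forall>\<^sub>F (x, y) in F \<times>\<^sub>F F. p \<alpha> (x - y) < \<epsilon>)"

definition seminorm_complete :: "('i \<Rightarrow> 'a::ab_group_add \<Rightarrow> real) \<Rightarrow> bool" where
  "seminorm_complete p \<longleftrightarrow>
     (\<forall>F. F \<noteq> bot \<longrightarrow> seminorm_cauchy_filter p F \<longrightarrow>
       (\<exists>l. limitin (seminorm_topology p) (\<lambda>x. x) l F))"

text \<open>The index set is a whole type \<open>'i\<close>, hence nonempty.\<close>

locale locally_cstar_algebra = complex_star_algebra cscale star
  for cscale :: "complex \<Rightarrow> 'a::ring_1 \<Rightarrow> 'a" and star :: "'a \<Rightarrow> 'a" +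
  fixes p :: "'i::order \<Rightarrow> 'a \<Rightarrow> real"
  assumes directed: "\<exists>\<delta>. \<alpha> \<le> \<delta> \<and> \<beta> \<le> \<delta>"
    and cstar: "cstar_seminorm cscale star (p \<alpha>)"
    and upward_filtered: "\<alpha> \<le> \<beta> \<Longrightarrow> p \<alpha> a \<le> p \<beta> a"
    and Hausdorff: "Hausdorff_space (seminorm_topology p)"
    and complete: "seminorm_complete p"

section \<open>The quotient algebras\<close>

definition null_ideal :: "('a::ring_1 \<Rightarrow> real) \<Rightarrow> 'a set" where
  "null_ideal q = {a. q a = 0}"

definition quot_map :: "('a::ring_1 \<Rightarrow> real) \<Rightarrow> 'a \<Rightarrow> 'a set" where
  "quot_map q a = (\<lambda>x. a + x) ` null_ideal q"

definition quot :: "('a::ring_1 \<Rightarrow> real) \<Rightarrow> 'a set set" where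
  "quot q = range (quot_map q)"

definition quot_add :: "('a::ring_1 \<Rightarrow> real) \<Rightarrow> 'a set \<Rightarrow> 'a set \<Rightarrow> 'a set" where
  "quot_add q X Y = (\<Union>x\<in>X. \<Union>y\<in>Y. quot_map q (x + y))"

definition quot_mult :: "('a::ring_1 \<Rightarrow> real) \<Rightarrow> 'a set \<Rightarrow> 'a set \<Rightarrow> 'a set" where
  "quot_mult q X Y = (\<Union>x\<in>X. \<Union>y\<in>Y. quot_map q (x * y))"

definition quot_scale ::
  "(complex \<Rightarrow> 'a::ring_1 \<Rightarrow> 'a) \<Rightarrow> ('a \<Rightarrow> real) \<Rightarrow> complex \<Rightarrow> 'a set \<Rightarrow> 'a set" where
  "quot_scale cscale q c X = (\<Union>x\<in>X. quot_map q (cscale c x))"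

text \<open>The map \<open>a + I\<^sub>\<beta> \<mapsto> a + I\<^sub>\<alpha>\<close>, given the smaller seminorm \<open>q = p \<alpha>\<close>.\<close>

definition conn_map :: "('a::ring_1 \<Rightarrow> real) \<Rightarrow> 'a set \<Rightarrow> 'a set" where
  "conn_map q X = (\<Union>x\<in>X. quot_map q x)"

lemma quot_map_eqI:
  assumes "vector_space cscale" "seminorm cscale q" "q (a - b) = 0"
  shows "quot_map q a = quot_map q b"
proof -
  interpret vector_space cscale by fact
  have neg: "q (- x) = q x" for x
  proof -
    have "q (cscale (- 1) x) = cmod (- 1) * q x" using assms(2) unfolding seminorm_def by blast
    then show ?thesis by simp
  qed
  have sub: "quot_map q u \<subseteq> quot_map q v" if uv: "q (u - v) = 0" for u v
  proof
    fix x assume "x \<in> quot_map q u"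
    then obtain n where n: "q n = 0" "x = u + n" by (auto simp: quot_map_def null_ideal_def)
    have "q ((u - v) + n) \<le> 0" "0 \<le> q ((u - v) + n)"
      using assms(2) n(1) uv unfolding seminorm_def by (metis add_0_right)+
    then have "q ((u - v) + n) = 0" by simp
    moreover have "x = v + ((u - v) + n)" using n by (simp add: algebra_simps)
    ultimately show "x \<in> quot_map q v" unfolding quot_map_def null_ideal_def by blast
  qed
  have "q (b - a) = 0" using neg[of "a - b"] assms(3) by simp
  then show ?thesis using sub assms(3) by blast
qed

lemma mem_quot_map: "x \<in> quot_map q a \<longleftrightarrow> q (x - a) = 0"
proof
  assume "x \<in> quot_map q a"
  then show "q (x - a) = 0" by (auto simp: quot_map_def null_ideal_def)
next
  assume "q (x - a) = 0"
  then have "x = a + (x - a)" "x - a \<in> null_ideal q" by (simp_all add: null_ideal_def)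
  then show "x \<in> quot_map q a" unfolding quot_map_def by blast
qed

lemma quot_operations:
  assumes "complex_star_algebra cscale star" and c: "cstar_seminorm cscale star q"
  shows "quot_add q (quot_map q a) (quot_map q b) = quot_map q (a + b)"
    and "quot_mult q (quot_map q a) (quot_map q b) = quot_map q (a * b)"
    and "quot_scale cscale q c (quot_map q a) = quot_map q (cscale c a)"
proof -
  interpret complex_star_algebra cscale star by fact
  have vs: "vector_space cscale" by unfold_locales
  have s: "seminorm cscale q" using c by (simp add: cstar_seminorm_def)
  have nn: "0 \<le> q x" and tri: "q (x + y) \<le> q x + q y"
    and hom: "q (cscale c x) = cmod c * q x" and sm: "q (x * y) \<le> q x * q y" for x y c
    using c by (auto simp: cstar_seminorm_def seminorm_def)
  have self: "x \<in> quot_map q x" for x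
    using hom[of 0 0] by (simp add: mem_quot_map)
  note eqI = quot_map_eqI[OF vs s]
  have add: "quot_map q (x + y) = quot_map q (a + b)"
    if "x \<in> quot_map q a" "y \<in> quot_map q b" for x y
  proof (rule eqI)
    have "q ((x - a) + (y - b)) \<le> 0"
      using tri[of "x - a" "y - b"] that by (simp add: mem_quot_map)
    then show "q (x + y - (a + b)) = 0"
      using nn[of "x + y - (a + b)"] by (simp add: algebra_simps)
  qed
  have mult: "quot_map q (x * y) = quot_map q (a * b)"
    if "x \<in> quot_map q a" "y \<in> quot_map q b" for x y
  proof (rule eqI)
    have e: "x * y - a * b = (x - a) * y + a * (y - b)" by (simp add: algebra_simps)
    have "q (x * y - a * b) \<le> 0"
      unfolding e using tri[of "(x - a) * y" "a * (y - b)"] sm[of "x - a" y] sm[of a "y - b"] that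
      by (simp add: mem_quot_map)
    then show "q (x * y - a * b) = 0" using nn[of "x * y - a * b"] by simp
  qed
  have sc: "quot_map q (cscale c x) = quot_map q (cscale c a)" if "x \<in> quot_map q a" for x
    by (rule eqI) (use that hom[of c "x - a"] in \<open>simp add: mem_quot_map scale_right_diff_distrib\<close>)
  show "quot_add q (quot_map q a) (quot_map q b) = quot_map q (a + b)"
    unfolding quot_add_def using add self by blast
  show "quot_mult q (quot_map q a) (quot_map q b) = quot_map q (a * b)"
    unfolding quot_mult_def using mult self by blast
  show "quot_scale cscale q c (quot_map q a) = quot_map q (cscale c a)"
    unfolding quot_scale_def using sc self by blast
qed

lemma conn_map_quot_map:
  assumes "vector_space cscale" "seminorm cscale q" "seminorm cscale r" "\<And>x. q x \<le> r x"
  shows "conn_map q (quot_map r a) = quot_map q a"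
proof -
  interpret vector_space cscale by fact
  have "quot_map q x = quot_map q a" if "x \<in> quot_map r a" for x
  proof (rule quot_map_eqI[OF assms(1,2)])
    have "q (x - a) \<le> 0" using assms(4)[of "x - a"] that by (simp add: mem_quot_map)
    then show "q (x - a) = 0" using assms(2) by (auto simp: seminorm_def intro: antisym)
  qed
  moreover have "r (cscale 0 0) = cmod 0 * r 0" using assms(3) unfolding seminorm_def by blast
  then have "a \<in> quot_map r a" by (simp add: mem_quot_map)
  ultimately show ?thesis unfolding conn_map_def by blast
qed

section \<open>Character spaces\<close>

text \<open>Functionals on \<open>quot q\<close> are represented by functions that are \<open>undefined\<close> off \<open>quot q\<close>.\<close>

definition quot_characters ::
  "(complex \<Rightarrow> 'a::ring_1 \<Rightarrow> 'a) \<Rightarrow> ('a \<Rightarrow> real) \<Rightarrow> ('a set \<Rightarrow> complex) set" where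
  "quot_characters cscale q = {\<phi> \<in> extensional (quot q).
     (\<forall>X\<in>quot q. \<forall>Y\<in>quot q. \<phi> (quot_add q X Y) = \<phi> X + \<phi> Y) \<and>
     (\<forall>c. \<forall>X\<in>quot q. \<phi> (quot_scale cscale q c X) = c * \<phi> X) \<and>
     (\<forall>X\<in>quot q. \<forall>Y\<in>quot q. \<phi> (quot_mult q X Y) = \<phi> X * \<phi> Y) \<and>
     (\<exists>X\<in>quot q. \<phi> X \<noteq> 0)}"

text \<open>The weak* topology is the topology of pointwise convergence.\<close>

definition quot_character_space ::
  "(complex \<Rightarrow> 'a::ring_1 \<Rightarrow> 'a) \<Rightarrow> ('a \<Rightarrow> real) \<Rightarrow> ('a set \<Rightarrow> complex) topology" where
  "quot_character_space cscale q =
     subtopology (product_topology (\<lambda>_. euclidean) (quot q)) (quot_characters cscale q)"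

lemma topspace_quot_character_space:
  "topspace (quot_character_space cscale q) = quot_characters cscale q"
  by (auto simp: quot_character_space_def quot_characters_def PiE_def)

definition gamma_conn ::
  "('i \<Rightarrow> 'a::ring_1 \<Rightarrow> real) \<Rightarrow> 'i \<Rightarrow> 'i \<Rightarrow> ('a set \<Rightarrow> complex) \<Rightarrow> 'a set \<Rightarrow> complex" where
  "gamma_conn p \<beta> \<alpha> \<phi> = restrict (\<phi> \<circ> conn_map (p \<alpha>)) (quot (p \<beta>))"

definition gamma :: "('i \<Rightarrow> 'a::ring_1 \<Rightarrow> real) \<Rightarrow> 'i \<Rightarrow> ('a set \<Rightarrow> complex) \<Rightarrow> 'a \<Rightarrow> complex" where
  "gamma p \<alpha> \<phi> = \<phi> \<circ> quot_map (p \<alpha>)"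

definition Z_set ::
  "(complex \<Rightarrow> 'a::ring_1 \<Rightarrow> 'a) \<Rightarrow> ('i \<Rightarrow> 'a \<Rightarrow> real) \<Rightarrow> 'i \<Rightarrow> ('a \<Rightarrow> complex) set" where
  "Z_set cscale p \<alpha> = gamma p \<alpha> ` quot_characters cscale (p \<alpha>)"

definition characters ::
  "(complex \<Rightarrow> 'a::ring_1 \<Rightarrow> 'a) \<Rightarrow> ('i \<Rightarrow> 'a \<Rightarrow> real) \<Rightarrow> ('a \<Rightarrow> complex) set" where
  "characters cscale p = (\<Union>\<alpha>. Z_set cscale p \<alpha>)"

definition Z_space ::
  "(complex \<Rightarrow> 'a::ring_1 \<Rightarrow> 'a) \<Rightarrow> ('i \<Rightarrow> 'a \<Rightarrow> real) \<Rightarrow> 'i \<Rightarrow> ('a \<Rightarrow> complex) topology" where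
  "Z_space cscale p \<alpha> =
     topology (\<lambda>U. \<exists>W. openin (quot_character_space cscale (p \<alpha>)) W \<and> U = gamma p \<alpha> ` W)"

definition character_space ::
  "(complex \<Rightarrow> 'a::ring_1 \<Rightarrow> 'a) \<Rightarrow> ('i \<Rightarrow> 'a \<Rightarrow> real) \<Rightarrow> ('a \<Rightarrow> complex) topology" where
  "character_space cscale p =
     topology (\<lambda>S. S \<subseteq> characters cscale p \<and>
       (\<forall>\<alpha>. openin (Z_space cscale p \<alpha>) (S \<inter> Z_set cscale p \<alpha>)))"

lemma inj_on_gamma: "inj_on (gamma p \<alpha>) (quot_characters cscale (p \<alpha>))"
proof (rule inj_onI)
  fix \<phi> \<psi> assume *: "\<phi> \<in> quot_characters cscale (p \<alpha>)" "\<psi> \<in> quot_characters cscale (p \<alpha>)"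
    "gamma p \<alpha> \<phi> = gamma p \<alpha> \<psi>"
  have "\<phi> X = \<psi> X" if "X \<in> quot (p \<alpha>)" for X
    using that fun_cong[OF *(3)] by (auto simp: quot_def gamma_def)
  with * show "\<phi> = \<psi>" by (auto simp: quot_characters_def intro: extensionalityI)
qed

lemma openin_Z_space:
  "openin (Z_space cscale p \<alpha>) U \<longleftrightarrow>
     (\<exists>W. openin (quot_character_space cscale (p \<alpha>)) W \<and> U = gamma p \<alpha> ` W)"
proof -
  let ?X = "quot_character_space cscale (p \<alpha>)"
  let ?P = "\<lambda>U. \<exists>W. openin ?X W \<and> U = gamma p \<alpha> ` W"
  have "istopology ?P"
    unfolding istopology_def
  proof (intro conjI allI impI)
    fix S T assume "?P S" "?P T"
    then obtain V W where VW: "openin ?X V" "openin ?X W"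
      "S = gamma p \<alpha> ` V" "T = gamma p \<alpha> ` W" by blast
    have "V \<subseteq> quot_characters cscale (p \<alpha>)" "W \<subseteq> quot_characters cscale (p \<alpha>)"
      using VW(1,2) openin_subset topspace_quot_character_space by metis+
    then have "S \<inter> T = gamma p \<alpha> ` (V \<inter> W)"
      using VW(3,4) inj_on_image_Int[OF inj_on_gamma] by metis
    then show "?P (S \<inter> T)" using VW(1,2) by blast
  next
    fix K assume "\<forall>S\<in>K. ?P S"
    then obtain f where f: "\<And>S. S \<in> K \<Longrightarrow> openin ?X (f S) \<and> S = gamma p \<alpha> ` f S"
      by metis
    then have "\<Union>K = gamma p \<alpha> ` (\<Union>(f ` K))" by blast
    moreover have "openin ?X (\<Union>(f ` K))" using f by blast
    ultimately show "?P (\<Union>K)" by blast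
  qed
  then show ?thesis unfolding Z_space_def by simp
qed

lemma openin_character_space:
  "openin (character_space cscale p) S \<longleftrightarrow>
     S \<subseteq> characters cscale p \<and> (\<forall>\<alpha>. openin (Z_space cscale p \<alpha>) (S \<inter> Z_set cscale p \<alpha>))"
proof -
  let ?P = "\<lambda>S. S \<subseteq> characters cscale p \<and>
    (\<forall>\<alpha>. openin (Z_space cscale p \<alpha>) (S \<inter> Z_set cscale p \<alpha>))"
  have "istopology ?P"
    unfolding istopology_def
  proof (intro conjI allI impI)
    fix S T \<alpha> assume "?P S" "?P T"
    then show "openin (Z_space cscale p \<alpha>) (S \<inter> T \<inter> Z_set cscale p \<alpha>)"
      using openin_Int[of "Z_space cscale p \<alpha>" "S \<inter> Z_set cscale p \<alpha>" "T \<inter> Z_set cscale p \<alpha>"]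
      by (simp add: Int_ac)
  next
    fix K \<alpha> assume K: "\<forall>S\<in>K. ?P S"
    have "openin (Z_space cscale p \<alpha>) (\<Union>S\<in>K. S \<inter> Z_set cscale p \<alpha>)"
      using K by (intro openin_Union) auto
    then show "openin (Z_space cscale p \<alpha>) (\<Union>K \<inter> Z_set cscale p \<alpha>)" by (simp add: Int_commute Int_Union)
  qed blast+
  then show ?thesis unfolding character_space_def by simp
qed

lemma topspace_Z_space: "topspace (Z_space cscale p \<alpha>) = Z_set cscale p \<alpha>"
proof
  show "topspace (Z_space cscale p \<alpha>) \<subseteq> Z_set cscale p \<alpha>"
    using openin_topspace[of "Z_space cscale p \<alpha>"] openin_subset
    unfolding openin_Z_space Z_set_def topspace_quot_character_space[symmetric] by blast
  show "Z_set cscale p \<alpha> \<subseteq> topspace (Z_space cscale p \<alpha>)"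
    by (rule openin_subset)
      (metis openin_Z_space Z_set_def topspace_quot_character_space openin_topspace)
qed

lemma topspace_character_space: "topspace (character_space cscale p) = characters cscale p"
proof
  show "topspace (character_space cscale p) \<subseteq> characters cscale p"
    using openin_topspace[of "character_space cscale p"] unfolding openin_character_space by blast
  have "characters cscale p \<inter> Z_set cscale p \<alpha> = topspace (Z_space cscale p \<alpha>)" for \<alpha>
    by (auto simp: characters_def topspace_Z_space)
  then show "characters cscale p \<subseteq> topspace (character_space cscale p)"
    by (intro openin_subset) (simp add: openin_character_space)
qed

section \<open>Inductive systems and inductive limits\<close>

text \<open>The map \<open>\<psi> \<beta> \<alpha>\<close> goes from \<open>X \<alpha>\<close> to \<open>X \<beta>\<close> and is relevant only for \<open>\<alpha> \<le> \<beta>\<close>.\<close>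

definition inductive_system ::
  "('i::order \<Rightarrow> 'x topology) \<Rightarrow> ('i \<Rightarrow> 'i \<Rightarrow> 'x \<Rightarrow> 'x) \<Rightarrow> bool" where
  "inductive_system X \<psi> \<longleftrightarrow>
     (\<forall>\<alpha> \<beta>. \<alpha> \<le> \<beta> \<longrightarrow> continuous_map (X \<alpha>) (X \<beta>) (\<psi> \<beta> \<alpha>)) \<and>
     (\<forall>\<alpha>. \<forall>x\<in>topspace (X \<alpha>). \<psi> \<alpha> \<alpha> x = x) \<and>
     (\<forall>\<alpha> \<beta> \<delta>. \<alpha> \<le> \<beta> \<longrightarrow> \<beta> \<le> \<delta> \<longrightarrow>
        (\<forall>x\<in>topspace (X \<alpha>). \<psi> \<delta> \<beta> (\<psi> \<beta> \<alpha> x) = \<psi> \<delta> \<alpha> x))"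

definition compatible_pair ::
  "('i::order \<Rightarrow> 'x topology) \<Rightarrow> ('i \<Rightarrow> 'i \<Rightarrow> 'x \<Rightarrow> 'x) \<Rightarrow>
     'y topology \<Rightarrow> ('i \<Rightarrow> 'x \<Rightarrow> 'y) \<Rightarrow> bool" where
  "compatible_pair X \<psi> Y \<kappa> \<longleftrightarrow>
     (\<forall>\<alpha>. continuous_map (X \<alpha>) Y (\<kappa> \<alpha>)) \<and>
     (\<forall>\<alpha> \<beta>. \<alpha> \<le> \<beta> \<longrightarrow> (\<forall>x\<in>topspace (X \<alpha>). \<kappa> \<beta> (\<psi> \<beta> \<alpha> x) = \<kappa> \<alpha> x))"

text \<open>
  HOL cannot quantify over types inside a formula, so the type \<open>'y\<close> carrying the test spaces \<open>Y\<close>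
  is a parameter, and a theorem asserting the property for a type variable \<open>'y\<close> covers all test
  spaces. The mediating map is taken to be \<open>undefined\<close> off \<open>topspace L\<close>, so that its uniqueness is
  uniqueness as a map on \<open>L\<close>.
\<close>

definition inductive_limit ::
  "'y itself \<Rightarrow> ('i::order \<Rightarrow> 'x topology) \<Rightarrow> ('i \<Rightarrow> 'i \<Rightarrow> 'x \<Rightarrow> 'x) \<Rightarrow>
     'l topology \<Rightarrow> ('i \<Rightarrow> 'x \<Rightarrow> 'l) \<Rightarrow> bool" where
  "inductive_limit t X \<psi> L L_map \<longleftrightarrow>
     compatible_pair X \<psi> L L_map \<and>
     (\<forall>(Y::'y topology) \<kappa>. compatible_pair X \<psi> Y \<kappa> \<longrightarrow>
        (\<exists>!k. k \<in> extensional (topspace L) \<and> continuous_map L Y k \<and>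
           (\<forall>\<alpha>. \<forall>x\<in>topspace (X \<alpha>). k (L_map \<alpha> x) = \<kappa> \<alpha> x)))"

end

theory Submission
  imports Defs
begin

text \<open>
  The one analytic point is compactness: a character \<open>\<phi>\<close> of \<open>\<A>\<close> that vanishes on the kernel of \<open>p \<alpha>\<close>
  must be bounded by a multiple of \<open>p \<alpha>\<close>. Neither completeness of the quotient by that kernel nor
  functional calculus is needed. If all seminorms of \<open>b\<close> are at most \<open>1\<close>, a
  Neumann series in \<open>\<A>\<close> gives \<open>\<bar>\<phi> b\<bar> \<le> 1\<close>. For self-adjoint \<open>k\<close> with \<open>p \<alpha> k \<le> 1/2\<close>, the Cayley transform
  yields \<open>e = (1 + k\<^sup>2)\<^sup>-\<^sup>1\<close> and \<open>S = 2ke\<close>, all of whose seminorms are at most \<open>1\<close>. With \<open>z = 2 - 2e\<close> one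
  has \<open>(2 - z) k = S\<close> and \<open>(1 - z)\<^sup>2 = 1 - S\<^sup>2\<close>; since \<open>p \<alpha> z \<le> 1\<close>, the element \<open>z\<close> agrees modulo the
  kernel of \<open>p \<alpha>\<close> with \<open>y = 1 - \<surd>(1 - S\<^sup>2)\<close>, which is bounded by \<open>1\<close> in every seminorm. Hence
  \<open>\<bar>\<phi> z\<bar> = \<bar>\<phi> y\<bar> \<le> 1\<close>, so \<open>\<bar>\<phi> k\<bar> \<le> \<bar>2 - \<phi> z\<bar> \<bar>\<phi> k\<bar> = \<bar>\<phi> S\<bar> \<le> 1\<close>.
\<close>

locale commutative_locally_cstar_algebra = locally_cstar_algebra cscale star p
  for cscale :: "complex \<Rightarrow> 'a::comm_ring_1 \<Rightarrow> 'a" and star :: "'a \<Rightarrow> 'a"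
    and p :: "'i::order \<Rightarrow> 'a \<Rightarrow> real"
begin

section \<open>Arithmetic of the seminorms and the involution\<close>

lemma seminorm_p: "seminorm cscale (p \<alpha>)"
  using cstar by (simp add: cstar_seminorm_def)

lemma p_nonneg [simp]: "0 \<le> p \<alpha> x"
  and p_add: "p \<alpha> (x + y) \<le> p \<alpha> x + p \<alpha> y"
  and p_cscale [simp]: "p \<alpha> (cscale c x) = cmod c * p \<alpha> x"
  using seminorm_p[of \<alpha>] by (auto simp: seminorm_def)

lemma p_one [simp]: "p \<alpha> 1 = 1"
  and p_mult: "p \<alpha> (x * y) \<le> p \<alpha> x * p \<alpha> y"
  and p_star [simp]: "p \<alpha> (star x) = p \<alpha> x"
  and p_star_mult: "p \<alpha> (star x * x) = (p \<alpha> x)\<^sup>2"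
  using cstar[of \<alpha>] by (auto simp: cstar_seminorm_def)

lemma p_zero [simp]: "p \<alpha> 0 = 0"
  using p_cscale[of \<alpha> 0 0] by simp

lemma p_minus [simp]: "p \<alpha> (- x) = p \<alpha> x"
  using p_cscale[of \<alpha> "-1" x] by simp

lemma p_diff: "p \<alpha> (x - y) \<le> p \<alpha> x + p \<alpha> y"
  using p_add[of \<alpha> x "- y"] by simp

lemma p_diff_commute: "p \<alpha> (x - y) = p \<alpha> (y - x)"
  using p_minus[of \<alpha> "x - y"] by simp

lemma p_power: "p \<alpha> (x ^ n) \<le> p \<alpha> x ^ n"
proof (induction n)
  case (Suc n)
  have "p \<alpha> (x ^ Suc n) \<le> p \<alpha> x * p \<alpha> (x ^ n)" using p_mult by simp
  also have "\<dots> \<le> p \<alpha> x * p \<alpha> x ^ n" by (intro mult_left_mono Suc) simp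
  finally show ?case by simp
qed simp

lemma star_zero [simp]: "star 0 = 0"
  using star_add[of 0 0] by simp

lemma star_one [simp]: "star 1 = 1"
  using star_mult[of "star 1" 1] by (simp add: star_star)

lemma star_minus [simp]: "star (- x) = - star x"
  using star_add[of x "- x"] by (simp add: eq_neg_iff_add_eq_0 add.commute)

lemma star_diff: "star (x - y) = star x - star y"
  using star_add[of x "- y"] by simp

lemma star_of_nat_mult: "star (of_nat n * x) = of_nat n * star x"
  by (induction n) (simp_all add: distrib_right star_add)

lemma cscale_numeral: "cscale (numeral n) x = numeral n * x"
proof -
  have "cscale (of_nat m) x = of_nat m * x" for m
    by (induction m) (simp_all add: scale_left_distrib distrib_right)
  from this[of "numeral n"] show ?thesis by simp
qed

lemma p_numeral_mult: "p \<alpha> (numeral n * x) = numeral n * p \<alpha> x"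
  using p_cscale[of \<alpha> "numeral n" x] by (simp add: cscale_numeral)

section \<open>Separation of points and limits of sequences\<close>

text \<open>If all seminorms vanish at x, then x and 0 have the same distance to every a, so they
  lie in the same subbasic sets and hence in the same open sets, against the Hausdorff
  property.\<close>

lemma separated:
  assumes "\<And>\<alpha>. p \<alpha> x = 0"
  shows "x = 0"
proof (rule ccontr)
  assume "x \<noteq> 0"
  have shift: "p \<alpha> (x - a) = p \<alpha> (0 - a)" for \<alpha> a
    using p_add[of \<alpha> x "0 - a"] p_diff[of \<alpha> "x - a" x] assms[of \<alpha>] by simp
  let ?B = "{{x. p \<alpha> (x - a) < \<epsilon>} | \<alpha> a \<epsilon>. \<epsilon> > 0}"
  have same: "x \<in> U \<longleftrightarrow> 0 \<in> U" if "generate_topology_on ?B U" for U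
    using that
  proof induction
    case (Basis s)
    then show ?case using shift by auto
  qed auto
  \<comment> \<open>\<open>Hausdorff_space\<close> speaks of points of the topspace only; a ball
    around y for an arbitrary index puts y there.\<close>
  have top: "y \<in> topspace (seminorm_topology p)" for y
  proof -
    have "y \<in> {x. p undefined (x - y) < 1}" by simp
    moreover have "{x. p undefined (x - y) < 1} \<in> ?B" using zero_less_one by blast
    ultimately show ?thesis unfolding seminorm_topology_def topology_generated_by_topspace by blast
  qed
  obtain U V where "openin (seminorm_topology p) U" "openin (seminorm_topology p) V"
    "x \<in> U" "0 \<in> V" "disjnt U V"
    using Hausdorff top \<open>x \<noteq> 0\<close> unfolding Hausdorff_space_def by meson
  then show False
    using same[of U] by (auto simp: seminorm_topology_def openin_topology_generated_by_iff disjnt_iff)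
qed

text \<open>Summable increments make the image filter Cauchy in each seminorm separately;
  completeness then yields one limit for all of them.\<close>

lemma sequential_limit:
  assumes "\<And>\<alpha>. summable (\<lambda>n. p \<alpha> (s (Suc n) - s n))"
  obtains l where "\<And>\<alpha>. (\<lambda>n. p \<alpha> (s n - l)) \<longlonglongrightarrow> 0"
proof -
  have step: "p \<alpha> (s n - s m) \<le> (\<Sum>i=m..<n. p \<alpha> (s (Suc i) - s i))" if "m \<le> n" for \<alpha> m n
    using that
  proof (induction n rule: dec_induct)
    case (step n)
    have "p \<alpha> (s (Suc n) - s m) \<le> p \<alpha> (s n - s m) + p \<alpha> (s (Suc n) - s n)"
      using p_add[of \<alpha> "s n - s m" "s (Suc n) - s n"] by simp
    with step show ?case by simp
  qed simp
  have cauchy: "\<exists>N. \<forall>m\<ge>N. \<forall>n\<ge>N. p \<alpha> (s n - s m) < \<epsilon>" if pos: "\<epsilon> > 0" for \<alpha> \<epsilon>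
  proof -
    obtain N where N: "\<forall>m\<ge>N. \<forall>n. norm (\<Sum>i=m..<n. p \<alpha> (s (Suc i) - s i)) < \<epsilon>"
      using assms[of \<alpha>] pos unfolding summable_Cauchy by blast
    have less: "p \<alpha> (s n - s m) < \<epsilon>" if "N \<le> m" "m \<le> n" for m n
      using N[rule_format, OF that(1), of n] step[OF that(2), of \<alpha>] by simp
    have "p \<alpha> (s n - s m) < \<epsilon>" if "N \<le> m" "N \<le> n" for m n
      using less[of m n] less[of n m] that p_diff_commute[of \<alpha> "s n" "s m"] by (cases "m \<le> n") auto
    then show ?thesis by blast
  qed
  let ?F = "filtermap s sequentially"
  have "seminorm_cauchy_filter p ?F"
    unfolding seminorm_cauchy_filter_def
  proof (intro allI impI)
    fix \<alpha> and \<epsilon> :: real assume "\<epsilon> > 0"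
    then obtain N where N: "\<forall>m\<ge>N. \<forall>n\<ge>N. p \<alpha> (s n - s m) < \<epsilon>" using cauchy by blast
    \<comment> \<open>Membership in the tail of \<open>s\<close> from \<open>N\<close> on serves as
      the predicate for both factors.\<close>
    show "\<forall>\<^sub>F (x, y) in ?F \<times>\<^sub>F ?F. p \<alpha> (x - y) < \<epsilon>"
      unfolding eventually_prod_filter
      by (intro exI[of _ "\<lambda>x. x \<in> s ` {N..}"])
        (use N in \<open>auto simp: eventually_filtermap eventually_sequentially intro!: exI[of _ N]\<close>)
  qed
  moreover have "?F \<noteq> bot" by (simp add: filtermap_bot_iff)
  ultimately obtain l where l: "limitin (seminorm_topology p) (\<lambda>x. x) l ?F"
    using complete unfolding seminorm_complete_def by blast
  have "(\<lambda>n. p \<alpha> (s n - l)) \<longlonglongrightarrow> 0" for \<alpha>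
  proof (rule tendstoI)
    fix \<epsilon> :: real assume "\<epsilon> > 0"
    then have "openin (seminorm_topology p) {x. p \<alpha> (x - l) < \<epsilon>}"
      unfolding seminorm_topology_def by (intro topology_generated_by_Basis) blast
    then have "\<forall>\<^sub>F x in ?F. p \<alpha> (x - l) < \<epsilon>"
      using l \<open>\<epsilon> > 0\<close> unfolding limitin_def by auto
    then show "\<forall>\<^sub>F n in sequentially. dist (p \<alpha> (s n - l)) 0 < \<epsilon>"
      by (simp add: eventually_filtermap)
  qed
  then show ?thesis using that by blast
qed

section \<open>Inverses as limits of approximate inverses\<close>

text \<open>Split \<open>1 - a * l\<close> as \<open>(1 - a * s n) + a * (s n - l)\<close>: both
  terms vanish in the limit for every seminorm, and the seminorms separate points.\<close>

lemma right_inverse_limit: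
  assumes "\<And>\<alpha>. (\<lambda>n. p \<alpha> (s n - l)) \<longlonglongrightarrow> 0" "\<And>\<alpha>. (\<lambda>n. p \<alpha> (1 - a * s n)) \<longlonglongrightarrow> 0"
  shows "a * l = 1"
proof -
  have "p \<alpha> (1 - a * l) = 0" for \<alpha>
  proof -
    have "p \<alpha> (1 - a * l) \<le> p \<alpha> (1 - a * s n) + p \<alpha> a * p \<alpha> (s n - l)" for n
      using p_add[of \<alpha> "1 - a * s n" "a * (s n - l)"] p_mult[of \<alpha> a "s n - l"]
      by (simp add: algebra_simps)
    moreover have "(\<lambda>n. p \<alpha> (1 - a * s n) + p \<alpha> a * p \<alpha> (s n - l)) \<longlonglongrightarrow> 0 + p \<alpha> a * 0"
      by (intro tendsto_intros assms)
    ultimately have "p \<alpha> (1 - a * l) \<le> 0"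
      by (intro LIMSEQ_le_const[of _ _ "p \<alpha> (1 - a * l)"]) auto
    then show ?thesis using p_nonneg by (simp add: antisym)
  qed
  then show ?thesis using separated[of "1 - a * l"] by simp
qed

text \<open>The partial sums of the geometric series have residual exactly \<open>b ^ n\<close>,
  which is at most \<open>r ^ n\<close> in every seminorm.\<close>

lemma neumann:
  assumes "\<And>\<alpha>. p \<alpha> b \<le> r" "r < 1"
  obtains l where "(1 - b) * l = 1"
proof -
  define s where "s n = (\<Sum>i<n. b ^ i)" for n
  have r0: "0 \<le> r" using assms(1) p_nonneg order_trans by blast
  have le: "p \<alpha> (b ^ n) \<le> r ^ n" for \<alpha> n
    using p_power[of \<alpha> b n] power_mono[OF assms(1)[of \<alpha>] p_nonneg, of n] by simp
  have "summable (\<lambda>n. p \<alpha> (s (Suc n) - s n))" for \<alpha>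
    by (rule summable_comparison_test'[where g="\<lambda>n. r ^ n"])
      (use le r0 assms(2) in \<open>auto simp: s_def intro: summable_geometric\<close>)
  then obtain l where l: "\<And>\<alpha>. (\<lambda>n. p \<alpha> (s n - l)) \<longlonglongrightarrow> 0" using sequential_limit by blast
  have "1 - (1 - b) * s n = b ^ n" for n
    using one_diff_power_eq[of b n] by (simp add: s_def algebra_simps)
  moreover have "(\<lambda>n. p \<alpha> (b ^ n)) \<longlonglongrightarrow> 0" for \<alpha>
    by (rule tendsto_sandwich[OF _ _ tendsto_const LIMSEQ_power_zero[of r]])
      (use le r0 assms(2) in auto)
  ultimately have "(1 - b) * l = 1" by (intro right_inverse_limit[OF l]) simp
  then show ?thesis using that by blast
qed

text \<open>The values \<open>p \<alpha> k\<close> may be unbounded in \<alpha>, and the estimate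
  \<open>sq\<close> makes a fixed step t > 0 contract only if
  \<open>t * (1 + (p \<alpha> k)\<^sup>2) < 2\<close>. Steps that decrease to 0 with divergent sum
  satisfy this eventually for each \<alpha>.\<close>

lemma one_plus_i_selfadjoint_inverse:
  assumes k: "star k = k"
  obtains x where "(1 + cscale \<i> k) * x = 1"
proof -
  \<comment> \<open>\<open>r n = 1 - a * s n\<close> is the product of the \<open>1 - 2a/(j + 2)\<close>, \<open>j < n\<close>. The C*-identity bounds the factors by
    \<open>(j + 1)/(j + 2)\<close> once \<open>j\<close> is large for the given seminorm, so one sequence converges in all of them.\<close>
  define a where "a = 1 + cscale \<i> k"
  define c where "c n = 2 / (real n + 2)" for n
  define s where "s = rec_nat 0 (\<lambda>n s. s + cscale (c n) (1 - a * s))"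
  have s_Suc: "s (Suc n) = s n + cscale (c n) (1 - a * s n)" for n by (simp add: s_def)
  define r where "r n = 1 - a * s n" for n
  have r_Suc: "r (Suc n) = (1 - cscale (c n) a) * r n" for n
    by (simp add: r_def s_Suc algebra_simps cscale_mult_left cscale_mult_right
        scale_right_diff_distrib)
  \<comment> \<open>As \<open>I * k\<close> is skew-adjoint, the cross terms cancel in the
    C*-identity. Writing t and the imaginary unit as algebra elements \<open>T\<close> and
    \<open>I\<close> turns the computation into commutative ring arithmetic.\<close>
  have sq: "(p \<alpha> (1 - cscale (complex_of_real t) a))\<^sup>2 \<le> (1 - t)\<^sup>2 + t\<^sup>2 * (p \<alpha> k)\<^sup>2" for \<alpha> t
  proof -
    define T where "T = cscale (complex_of_real t) 1"
    define I where "I = cscale \<i> 1"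
    have II: "I * I = -1" by (simp add: I_def cscale_mult_left)
    have e: "1 - cscale t a = (1 - T) - T * I * k"
      by (simp add: a_def T_def I_def cscale_mult_left cscale_mult_right algebra_simps)
    have "star T = T" "star I = - I" by (simp_all add: T_def I_def star_cscale)
    then have "star (1 - cscale t a) = (1 - T) + T * I * k"
      unfolding e by (simp add: star_diff star_mult k mult_ac)
    then have "star (1 - cscale t a) * (1 - cscale t a) =
        ((1 - T) + T * I * k) * ((1 - T) - T * I * k)"
      by (simp only: e)
    also have "\<dots> = (1 - T)\<^sup>2 - T\<^sup>2 * (I * I) * k\<^sup>2"
      by (simp add: algebra_simps power2_eq_square)
    also have "\<dots> = cscale (complex_of_real ((1 - t)\<^sup>2)) 1 + cscale (complex_of_real (t\<^sup>2)) (k * k)"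
    proof -
      have "1 - T = cscale (complex_of_real (1 - t)) 1" by (simp add: T_def scale_left_diff_distrib)
      then have "(1 - T)\<^sup>2 = cscale (complex_of_real ((1 - t)\<^sup>2)) 1"
        by (simp add: power2_eq_square cscale_mult_left)
      moreover have "T\<^sup>2 * k\<^sup>2 = cscale (complex_of_real (t\<^sup>2)) (k * k)"
        by (simp add: T_def power2_eq_square cscale_mult_left cscale_mult_right mult_ac)
      ultimately show ?thesis unfolding II by simp
    qed
    finally have "(p \<alpha> (1 - cscale t a))\<^sup>2 =
        p \<alpha> (cscale (complex_of_real ((1 - t)\<^sup>2)) 1 + cscale (complex_of_real (t\<^sup>2)) (star k * k))"
      by (simp add: p_star_mult[symmetric] k)
    also have "\<dots> \<le> p \<alpha> (cscale (complex_of_real ((1 - t)\<^sup>2)) 1) +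
        p \<alpha> (cscale (complex_of_real (t\<^sup>2)) (star k * k))"
      by (rule p_add)
    also have "\<dots> = (1 - t)\<^sup>2 + t\<^sup>2 * (p \<alpha> k)\<^sup>2"
      unfolding p_cscale p_star_mult
      by (simp del: of_real_power)
    finally show ?thesis .
  qed
  have "\<exists>C. \<forall>\<^sub>F n in sequentially. p \<alpha> (r n) \<le> C / (real n + 1)" for \<alpha>
  proof -
    \<comment> \<open>From \<open>N\<close> on,
      \<open>c n * (1 + (p \<alpha> k)\<^sup>2) \<le> 1\<close>, so the bound of \<open>sq\<close>
      is at most \<open>1 - c n\<close>, hence at most \<open>(1 - c n / 2)\<^sup>2\<close>.\<close>
    define N where "N = nat \<lceil>2 * (1 + (p \<alpha> k)\<^sup>2)\<rceil>"
    have fac: "p \<alpha> (1 - cscale (c n) a) \<le> (real n + 1) / (real n + 2)" if "n \<ge> N" for n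
    proof (rule power2_le_imp_le)
      have "2 * (1 + (p \<alpha> k)\<^sup>2) \<le> real n + 2"
        using that unfolding N_def by linarith
      then have "c n * (1 + (p \<alpha> k)\<^sup>2) \<le> 1" by (simp add: c_def field_simps)
      then have "c n * (c n * (1 + (p \<alpha> k)\<^sup>2)) \<le> c n * 1"
        by (intro mult_left_mono) (auto simp: c_def)
      moreover have "(1 - c n / 2)\<^sup>2 - ((1 - c n)\<^sup>2 + (c n)\<^sup>2 * (p \<alpha> k)\<^sup>2) =
          c n - c n * (c n * (1 + (p \<alpha> k)\<^sup>2)) + (c n)\<^sup>2 / 4"
        by (simp add: power2_eq_square algebra_simps)
      ultimately have "(1 - c n)\<^sup>2 + (c n)\<^sup>2 * (p \<alpha> k)\<^sup>2 \<le> (1 - c n / 2)\<^sup>2"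
        using zero_le_power2[of "c n"] by linarith
      also have "1 - c n / 2 = (real n + 1) / (real n + 2)" by (simp add: c_def field_simps)
      finally show "(p \<alpha> (1 - cscale (c n) a))\<^sup>2 \<le> ((real n + 1) / (real n + 2))\<^sup>2"
        using sq order_trans by blast
    qed simp
    \<comment> \<open>The factors (j + 1)/(j + 2) for N \<le> j < n telescope to (N + 1)/(n +
      1).\<close>
    have "p \<alpha> (r n) \<le> (real N + 1) * p \<alpha> (r N) / (real n + 1)" if "n \<ge> N" for n
      using that
    proof (induction n rule: dec_induct)
      case (step n)
      have "p \<alpha> (r (Suc n)) \<le> p \<alpha> (1 - cscale (c n) a) * p \<alpha> (r n)"
        unfolding r_Suc by (rule p_mult)
      also have "\<dots> \<le> (real n + 1) / (real n + 2) * ((real N + 1) * p \<alpha> (r N) / (real n + 1))"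
        by (intro mult_mono fac step) auto
      also have "\<dots> = (real N + 1) * p \<alpha> (r N) / (real (Suc n) + 1)"
        by (simp add: divide_simps)
      finally show ?case .
    qed simp
    then show ?thesis unfolding eventually_sequentially by blast
  qed
  then obtain C where C: "\<And>\<alpha>. \<forall>\<^sub>F n in sequentially. p \<alpha> (r n) \<le> C \<alpha> / (real n + 1)" by metis
  \<comment> \<open>An increment is \<open>c n\<close> times the residual; each is O(1/n), so their
    product is summable.\<close>
  have "summable (\<lambda>n. p \<alpha> (s (Suc n) - s n))" for \<alpha>
  proof (rule summable_comparison_test_ev)
    have "summable (\<lambda>n. inverse (real (Suc n) ^ 2))"
      using inverse_power_summable[of 2, where 'a=real]
      by (subst summable_Suc_iff[of "\<lambda>n. inverse (real n ^ 2)"]) auto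
    then show "summable (\<lambda>n. 2 * C \<alpha> * inverse (real (Suc n) ^ 2))" by (rule summable_mult)
    show "\<forall>\<^sub>F n in sequentially. norm (p \<alpha> (s (Suc n) - s n)) \<le> 2 * C \<alpha> * inverse (real (Suc n) ^ 2)"
      using C[of \<alpha>]
    proof eventually_elim
      case (elim n)
      have "0 \<le> c n" by (simp add: c_def)
      then have "p \<alpha> (s (Suc n) - s n) = c n * p \<alpha> (r n)"
        by (simp add: s_Suc r_def)
      also have "\<dots> \<le> (2 / (real n + 1)) * (C \<alpha> / (real n + 1))"
        by (intro mult_mono elim) (auto simp: c_def field_simps)
      also have "\<dots> = 2 * C \<alpha> * inverse (real (Suc n) ^ 2)"
        by (simp add: field_simps power2_eq_square)
      finally show ?case by simp
    qed
  qed
  then obtain l where l: "\<And>\<alpha>. (\<lambda>n. p \<alpha> (s n - l)) \<longlonglongrightarrow> 0" using sequential_limit by blast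
  have "(\<lambda>n. p \<alpha> (r n)) \<longlonglongrightarrow> 0" for \<alpha>
  proof (rule tendsto_sandwich[OF _ C tendsto_const])
    show "(\<lambda>n. C \<alpha> / (real n + 1)) \<longlonglongrightarrow> 0"
      using tendsto_mult[OF tendsto_const[of "C \<alpha>"] LIMSEQ_inverse_real_of_nat]
      by (simp add: divide_inverse add.commute)
  qed simp
  then have "a * l = 1" unfolding r_def by (rule right_inverse_limit[OF l])
  then show ?thesis using that unfolding a_def by blast
qed

section \<open>Square roots by monotone iteration\<close>

text \<open>The scalar iteration for 1 - \<surd>(1 - u) at u = 1. Its increments are
  \<open>(1 - t n)\<^sup>2 / 2\<close>, and the limit satisfies
  \<open>(1 - L)\<^sup>2 = 0\<close>.\<close>

lemma sqrt_majorant_tendsto: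
  fixes t :: "nat \<Rightarrow> real"
  assumes t: "t 0 = 0" "\<And>n. t (Suc n) = (1 + (t n)\<^sup>2) / 2"
  shows "0 \<le> t n" "t n \<le> 1" "t n \<le> t (Suc n)" "t \<longlonglongrightarrow> 1"
proof -
  have nn: "0 \<le> t n" for n by (cases n) (simp_all add: t)
  have le: "t n \<le> 1" for n
  proof (induction n)
    case (Suc n)
    then have "(t n)\<^sup>2 \<le> 1" using nn by (simp add: power_le_one)
    then show ?case by (simp add: t)
  qed (simp add: t)
  have mono: "t n \<le> t (Suc n)" for n
    using zero_le_power2[of "1 - t n"] by (simp add: t power2_diff)
  then have "incseq t" by (intro incseq_SucI)
  then obtain L where L: "t \<longlonglongrightarrow> L" using incseq_convergent[of t 1] le by blast
  have "(\<lambda>n. t (Suc n)) \<longlonglongrightarrow> (1 + L\<^sup>2) / 2"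
    unfolding t by (intro tendsto_intros L) auto
  then have "L = (1 + L\<^sup>2) / 2" using LIMSEQ_Suc[OF L] LIMSEQ_unique by blast
  then have "(1 - L)\<^sup>2 = 0" by (simp add: power2_diff)
  then show "t \<longlonglongrightarrow> 1" using L by simp
  show "0 \<le> t n" "t n \<le> 1" "t n \<le> t (Suc n)" by (fact nn le mono)+
qed

text \<open>
  The element \<open>y\<close> is \<open>1 - \<surd>(1 - u)\<close>, the limit of \<open>y' = (u + y\<^sup>2)/2\<close>. The increments are polynomials in \<open>u\<close>
  with nonnegative coefficients, hence majorized by those of the scalar iteration with \<open>u = 1\<close>.
\<close>

lemma bounded_sqrt:
  assumes u: "\<And>\<alpha>. p \<alpha> u \<le> 1"
  obtains y where "\<And>\<alpha>. p \<alpha> y \<le> 1"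
    "\<And>\<alpha> z. p \<alpha> z \<le> 1 \<Longrightarrow> 2 * z = u + z\<^sup>2 \<Longrightarrow> p \<alpha> (y - z) = 0"
proof -
  define h where "h = cscale (1/2) 1"
  define t :: "nat \<Rightarrow> real" where "t = rec_nat 0 (\<lambda>n t. (1 + t\<^sup>2) / 2)"
  define y where "y = rec_nat 0 (\<lambda>n y. h * (u + y\<^sup>2))"
  have ph: "p \<alpha> (h * x) = p \<alpha> x / 2" for \<alpha> x
    by (simp add: h_def cscale_mult_left norm_divide)
  have t: "t 0 = 0" "t (Suc n) = (1 + (t n)\<^sup>2) / 2" for n by (simp_all add: t_def)
  note t_props = sqrt_majorant_tendsto[OF t]
  have y: "y 0 = 0" "y (Suc n) = h * (u + (y n)\<^sup>2)" for n by (simp_all add: y_def)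
  have yt: "p \<alpha> (y n) \<le> t n" for \<alpha> n
  proof (induction n)
    case (Suc n)
    have "p \<alpha> (u + (y n)\<^sup>2) \<le> 1 + (t n)\<^sup>2"
      using p_add[of \<alpha> u "(y n)\<^sup>2"] u[of \<alpha>] p_power[of \<alpha> "y n" 2] power_mono[OF Suc p_nonneg, of 2]
      by linarith
    then show ?case by (simp add: y t ph)
  qed (simp add: y t)
  \<comment> \<open>The difference of squares in factored form; it drives both the estimate of the
    increments and the comparison with another solution z.\<close>
  have product: "p \<alpha> (h * ((a - b) * (a + b))) \<le> d * s / 2"
    if "p \<alpha> (a - b) \<le> d" "p \<alpha> a + p \<alpha> b \<le> s" for \<alpha> a b d s
  proof -
    have "p \<alpha> ((a - b) * (a + b)) \<le> p \<alpha> (a - b) * p \<alpha> (a + b)" by (rule p_mult)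
    also have "\<dots> \<le> d * s"
      using that p_add[of \<alpha> a b] order_trans[OF p_nonneg that(1)] by (intro mult_mono) auto
    finally show ?thesis by (simp add: ph)
  qed
  have step: "p \<alpha> (y (Suc n) - y n) \<le> t (Suc n) - t n" for \<alpha> n
  proof (induction n)
    case 0
    then show ?case using yt[of \<alpha> "Suc 0"] by (simp add: y t)
  next
    case (Suc n)
    have "y (Suc (Suc n)) - y (Suc n) = h * (u + (y (Suc n))\<^sup>2) - h * (u + (y n)\<^sup>2)"
      by (simp only: y(2))
    also have "\<dots> = h * ((y (Suc n) - y n) * (y (Suc n) + y n))"
      by (simp add: power2_eq_square algebra_simps)
    also have "p \<alpha> \<dots> \<le> (t (Suc n) - t n) * (t (Suc n) + t n) / 2"
      by (intro product Suc add_mono yt)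
    also have "\<dots> = t (Suc (Suc n)) - t (Suc n)"
      by (simp add: t(2)[of "Suc n"] t(2)[of n] power2_eq_square field_simps del: t(2))
    finally show ?case .
  qed
  have "summable (\<lambda>n. p \<alpha> (y (Suc n) - y n))" for \<alpha>
    using step by (intro summable_comparison_test'[OF telescope_summable[OF t_props(4)]]) simp
  then obtain l where l: "\<And>\<alpha>. (\<lambda>n. p \<alpha> (y n - l)) \<longlonglongrightarrow> 0" using sequential_limit by blast
  \<comment> \<open>Bounds on the iterates pass to the limit; used with x = 0 for the size of
    \<open>l\<close> and with x = z to identify \<open>l\<close> with z.\<close>
  have le: "p \<alpha> (l - x) \<le> d" if "e \<longlonglongrightarrow> d" "\<And>n. p \<alpha> (y n - x) \<le> e n" for \<alpha> x d e
  proof (rule LIMSEQ_le_const)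
    show "(\<lambda>n. p \<alpha> (y n - l) + e n) \<longlonglongrightarrow> d" using tendsto_add[OF l that(1)] by simp
    have "p \<alpha> (l - x) \<le> p \<alpha> (y n - l) + e n" for n
      using p_add[of \<alpha> "l - y n" "y n - x"] that(2)[of n] p_diff_commute[of \<alpha> l "y n"] by simp
    then show "\<exists>N. \<forall>n\<ge>N. p \<alpha> (l - x) \<le> p \<alpha> (y n - l) + e n" by blast
  qed
  have "p \<alpha> l \<le> 1" for \<alpha>
    using le[OF t_props(4), of \<alpha> 0] yt by simp
  moreover have "p \<alpha> (l - z) = 0" if z: "p \<alpha> z \<le> 1" "2 * z = u + z\<^sup>2" for \<alpha> z
  proof -
    have "h * 2 = 1"
      using cscale_numeral[of "num.Bit0 num.One" h]
      by (simp add: h_def mult.commute)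
    then have hz: "z = h * (u + z\<^sup>2)" by (metis z(2) mult.assoc mult_1)
    \<comment> \<open>The fixed point 1 of the scalar iteration majorizes z in this one seminorm, as
      \<open>t n\<close> majorizes \<open>y n\<close>. So \<open>1 - t n\<close>, which tends to 0,
      bounds the distance from z to the iterates.\<close>
    have d: "p \<alpha> (z - y n) \<le> 1 - t n" for n
    proof (induction n)
      case 0
      then show ?case using z by (simp add: y t)
    next
      case (Suc n)
      have "z - y (Suc n) = h * ((z - y n) * (z + y n))"
        by (subst hz) (simp add: y power2_eq_square algebra_simps)
      also have "p \<alpha> \<dots> \<le> (1 - t n) * (1 + t n) / 2"
        by (intro product Suc add_mono yt z)
      also have "\<dots> = 1 - t (Suc n)" by (simp add: t power2_eq_square field_simps)
      finally show ?case .
    qed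
    have "(\<lambda>n. 1 - t n) \<longlonglongrightarrow> 1 - 1" by (intro tendsto_intros t_props(4))
    then have "p \<alpha> (l - z) \<le> 1 - 1" by (rule le) (metis d p_diff_commute)
    then show ?thesis using p_nonneg by (simp add: antisym)
  qed
  ultimately show ?thesis using that by blast
qed

section \<open>Boundedness of characters\<close>

text \<open>A purely algebraic notion; \<open>character_bound\<close> derives boundedness by a
  seminorm from vanishing on its null ideal.\<close>

definition is_character :: "('a \<Rightarrow> complex) \<Rightarrow> bool" where
  "is_character \<phi> \<longleftrightarrow> (\<forall>x y. \<phi> (x + y) = \<phi> x + \<phi> y) \<and> (\<forall>c x. \<phi> (cscale c x) = c * \<phi> x) \<and>
     (\<forall>x y. \<phi> (x * y) = \<phi> x * \<phi> y) \<and> (\<exists>x. \<phi> x \<noteq> 0)"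

context
  fixes \<phi> assumes \<phi>: "is_character \<phi>"
begin

lemma character_simps [simp]:
  "\<phi> (x + y) = \<phi> x + \<phi> y" "\<phi> (cscale c x) = c * \<phi> x" "\<phi> (x * y) = \<phi> x * \<phi> y"
  using \<phi> by (auto simp: is_character_def)

lemma character_one [simp]: "\<phi> 1 = 1"
proof -
  obtain x where "\<phi> x \<noteq> 0" using \<phi> by (auto simp: is_character_def)
  then show ?thesis using character_simps(3)[of 1 x] by simp
qed

lemma character_diff [simp]: "\<phi> (x - y) = \<phi> x - \<phi> y"
  using character_simps(1)[of "x - y" y] by (simp del: character_simps)

lemma character_numeral [simp]: "\<phi> (numeral n) = numeral n"
  using character_simps(2)[of "numeral n" 1] by (simp add: cscale_numeral del: character_simps)

text \<open>If \<open>\<phi> b\<close> had modulus above 1, then 1 minus b divided by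
  \<open>\<phi> b\<close> would be invertible by \<open>neumann\<close>, although
  \<open>\<phi>\<close> sends it to 0.\<close>

lemma character_bounded:
  assumes b: "\<And>\<alpha>. p \<alpha> b \<le> 1"
  shows "cmod (\<phi> b) \<le> 1"
proof (rule ccontr)
  assume "\<not> ?thesis"
  then have gt: "cmod (\<phi> b) > 1" by simp
  have "p \<alpha> (cscale (inverse (\<phi> b)) b) \<le> inverse (cmod (\<phi> b))" for \<alpha>
    using mult_left_mono[OF b, of "inverse (cmod (\<phi> b))"] unfolding p_cscale norm_inverse by simp
  moreover have "inverse (cmod (\<phi> b)) < 1" using gt by (simp add: inverse_less_1_iff)
  ultimately obtain l where "(1 - cscale (inverse (\<phi> b)) b) * l = 1" using neumann by blast
  then have "\<phi> ((1 - cscale (inverse (\<phi> b)) b) * l) = \<phi> 1" by (rule arg_cong)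
  moreover have "\<phi> b \<noteq> 0" using gt by auto
  ultimately show False by simp
qed

lemma character_selfadjoint_bound:
  assumes kernel: "\<And>x. p \<alpha> x = 0 \<Longrightarrow> \<phi> x = 0"
    and k: "star k = k" "p \<alpha> k \<le> 1/2"
  shows "cmod (\<phi> k) \<le> 1"
proof -
  define I where "I = cscale \<i> 1"
  have II: "I * I = -1" and sI: "star I = - I"
    by (simp_all add: I_def cscale_mult_left star_cscale)
  have pI: "p \<beta> (I * x) = p \<beta> x" for \<beta> x by (simp add: I_def cscale_mult_left)
  obtain x where "(1 + cscale \<i> k) * x = 1" using one_plus_i_selfadjoint_inverse[OF k(1)] .
  then have x: "(1 + I * k) * x = 1" by (simp add: I_def cscale_mult_left)
  define x' where "x' = star x"
  have x': "(1 - I * k) * x' = 1"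
    using arg_cong[OF x, of star] by (simp add: star_mult star_add sI k x'_def mult.commute)
  define e where "e = x * x'"
  \<comment> \<open>As x inverts \<open>1 + I * k\<close>, this is the Cayley transform
    \<open>(1 - I * k) * x\<close>. It is unitary, so the C*-identity gives it seminorm 1
    everywhere.\<close>
  define U where "U = 2 * x - 1"
  have sU: "star U = 2 * x' - 1"
    using star_of_nat_mult[of 2 x] by (simp add: U_def star_diff x'_def)
  have "U = (1 - I * k) * x" "2 * x' - 1 = (1 + I * k) * x'"
    using x x' by (simp_all add: U_def algebra_simps)
  then have "star U * U = ((1 + I * k) * x) * ((1 - I * k) * x')"
    unfolding sU by (simp only: mult_ac)
  then have "star U * U = 1" by (simp only: x x' mult_1)
  then have "(p \<beta> U)\<^sup>2 = 1" for \<beta> using p_star_mult[of \<beta> U] by simp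
  then have pU: "p \<beta> U = 1" for \<beta> using power2_eq_imp_eq[of "p \<beta> U" 1] by simp
  have "1 + k\<^sup>2 = 1 - I * I * k\<^sup>2" unfolding II by simp
  also have "\<dots> = (1 + I * k) * (1 - I * k)" by (simp add: power2_eq_square algebra_simps)
  finally have "e * (1 + k\<^sup>2) = ((1 + I * k) * x) * ((1 - I * k) * x')"
    unfolding e_def by (simp only: mult_ac)
  then have "e * (1 + k\<^sup>2) = 1" by (simp only: x x' mult_1)
  then have ek: "k\<^sup>2 * e = 1 - e" by (simp add: algebra_simps)
  \<comment> \<open>Up to sign the imaginary part of the unitary \<open>U\<close>, whence the bound
    in every seminorm.\<close>
  define S where "S = 2 * k * e"
  have pS: "p \<beta> S \<le> 1" for \<beta>
  proof -
    have "x' = e * (1 + I * k)" "x = e * (1 - I * k)"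
      using arg_cong[OF x, of "\<lambda>w. x' * w"] arg_cong[OF x', of "\<lambda>w. x * w"]
      by (simp_all add: e_def mult_ac)
    then have "2 * x' - 2 * x = 2 * (e * (1 + I * k)) - 2 * (e * (1 - I * k))"
      by (simp only: refl)
    then have "star U - U = 2 * (e * (1 + I * k)) - 2 * (e * (1 - I * k))"
      unfolding sU by (simp add: U_def)
    then have "star U - U = 2 * (I * S)" by (simp add: S_def algebra_simps)
    moreover have "p \<beta> (star U - U) \<le> 2" using p_diff[of \<beta> "star U" U] by (simp add: pU)
    ultimately show ?thesis by (simp add: p_numeral_mult pI)
  qed
  have pe: "p \<beta> e \<le> 1" for \<beta>
  proof -
    have "p \<beta> (2 * x) \<le> 2" using p_add[of \<beta> U 1] by (simp add: U_def pU[unfolded U_def])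
    then have "p \<beta> x \<le> 1" by (simp add: p_numeral_mult)
    then show ?thesis using p_star_mult[of \<beta> x] by (simp add: e_def x'_def mult.commute power_le_one)
  qed
  have "p \<beta> (S\<^sup>2) \<le> 1" for \<beta>
    using p_power[of \<beta> S 2] pS[of \<beta>] by (meson order_trans p_nonneg power_le_one)
  then obtain y where y: "\<And>\<beta>. p \<beta> y \<le> 1"
    "\<And>\<beta> z. p \<beta> z \<le> 1 \<Longrightarrow> 2 * z = S\<^sup>2 + z\<^sup>2 \<Longrightarrow> p \<beta> (y - z) = 0"
    using bounded_sqrt by blast
  \<comment> \<open>Here \<open>1 - z = 2 * e - 1\<close> is the real part of \<open>U\<close>, so
    \<open>2 * z = S\<^sup>2 + z\<^sup>2\<close> says that the squares of the real and imaginary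
    parts of \<open>U\<close> add up to 1.\<close>
  define z where "z = 2 - 2 * e"
  \<comment> \<open>Since z is \<open>2 * (k\<^sup>2 * e)\<close>, the bound 1/2 on k suffices. It
    selects the same branch of the root as y, but only in the seminorm \<alpha>; hence the appeal to
    \<open>kernel\<close>.\<close>
  have "p \<alpha> z \<le> 1"
  proof -
    have "z = 2 * (k\<^sup>2 * e)" unfolding z_def ek by (simp add: algebra_simps)
    then have "p \<alpha> z = 2 * p \<alpha> (k\<^sup>2 * e)" by (simp add: p_numeral_mult)
    also have "\<dots> \<le> 2 * (p \<alpha> (k\<^sup>2) * p \<alpha> e)" using p_mult by simp
    also have "p \<alpha> (k\<^sup>2) \<le> (1/2)\<^sup>2"
      using p_power[of \<alpha> k 2] power_mono[OF k(2) p_nonneg, of 2] by (rule order_trans)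
    then have "2 * (p \<alpha> (k\<^sup>2) * p \<alpha> e) \<le> 2 * ((1/2)\<^sup>2 * 1)"
      using pe by (intro mult_left_mono mult_mono) simp_all
    finally show ?thesis by (simp add: power2_eq_square)
  qed
  moreover have "2 * z = S\<^sup>2 + z\<^sup>2"
  proof -
    have "S\<^sup>2 = 4 * (k\<^sup>2 * e) * e" by (simp add: S_def power2_eq_square mult_ac)
    then show ?thesis unfolding ek by (simp add: z_def power2_eq_square algebra_simps)
  qed
  ultimately have "\<phi> (y - z) = 0" using y(2) kernel by blast
  then have "\<phi> z = \<phi> y" by simp
  then have "cmod (\<phi> z) \<le> 1" using character_bounded y(1) by simp
  then have "1 \<le> cmod (2 - \<phi> z)" using norm_triangle_ineq2[of 2 "\<phi> z"] by simp
  then have "cmod (\<phi> k) \<le> cmod (2 - \<phi> z) * cmod (\<phi> k)"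
    using mult_right_mono[of 1 "cmod (2 - \<phi> z)" "cmod (\<phi> k)"] by simp
  also have "\<dots> = cmod (\<phi> ((2 - z) * k))" by (simp add: norm_mult)
  also have "(2 - z) * k = S" by (simp add: z_def S_def algebra_simps)
  also have "cmod (\<phi> S) \<le> 1" using character_bounded pS by blast
  finally show ?thesis .
qed

text \<open>Scaling to seminorm 1/2 gives the constant 2 for self-adjoint elements. Then
  \<open>2 * a\<close> is \<open>h\<close> plus the imaginary unit times \<open>g\<close>, both
  self-adjoint of seminorm at most \<open>2 * p \<alpha> a\<close>, which makes the constant
  4.\<close>

lemma character_bound:
  assumes kernel: "\<And>x. p \<alpha> x = 0 \<Longrightarrow> \<phi> x = 0"
  shows "cmod (\<phi> a) \<le> 4 * p \<alpha> a"
proof -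
  have sa: "cmod (\<phi> k) \<le> 2 * p \<alpha> k" if k: "star k = k" for k
  proof (cases "p \<alpha> k = 0")
    case False
    then have pos: "p \<alpha> k > 0" by (simp add: order_less_le)
    define c where "c = inverse (2 * p \<alpha> k)"
    have "cmod (\<phi> (cscale (complex_of_real c) k)) \<le> 1"
      using pos k by (intro character_selfadjoint_bound[OF kernel])
        (auto simp: star_cscale c_def norm_mult norm_inverse)
    then show ?thesis using pos by (simp add: norm_mult norm_inverse norm_divide c_def field_simps)
  qed (simp add: kernel)
  define h where "h = a + star a"
  define g where "g = cscale \<i> (star a - a)"
  have "star h = h" by (simp add: h_def star_add star_star)
  moreover have "star g = g" by (simp add: g_def star_cscale star_diff star_star flip: scale_minus_right)
  ultimately have "cmod (\<phi> h) \<le> 2 * p \<alpha> h" "cmod (\<phi> g) \<le> 2 * p \<alpha> g" by (auto intro: sa)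
  moreover have "p \<alpha> h \<le> 2 * p \<alpha> a" "p \<alpha> g \<le> 2 * p \<alpha> a"
    using p_add[of \<alpha> a "star a"] p_diff[of \<alpha> "star a" a] by (simp_all add: h_def g_def)
  ultimately have "cmod (\<phi> h + \<i> * \<phi> g) \<le> 8 * p \<alpha> a"
    using norm_triangle_ineq[of "\<phi> h" "\<i> * \<phi> g"] by (simp add: norm_mult)
  moreover have "\<phi> h + \<i> * \<phi> g = 2 * \<phi> a" by (simp add: h_def g_def algebra_simps)
  ultimately show ?thesis by (simp add: norm_mult)
qed

end

section \<open>Characters of the quotients and compactness\<close>

lemma quot_map_in_quot [simp]: "quot_map q a \<in> quot q"
  by (simp add: quot_def)

lemma quot_operations_p [simp]:
  "quot_add (p \<alpha>) (quot_map (p \<alpha>) a) (quot_map (p \<alpha>) b) = quot_map (p \<alpha>) (a + b)"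
  "quot_mult (p \<alpha>) (quot_map (p \<alpha>) a) (quot_map (p \<alpha>) b) = quot_map (p \<alpha>) (a * b)"
  "quot_scale cscale (p \<alpha>) c (quot_map (p \<alpha>) a) = quot_map (p \<alpha>) (cscale c a)"
  using quot_operations[OF complex_star_algebra_axioms cstar] by auto

text \<open>Coset operations act on representatives, so the bounds for characters of the algebra
  become available on the quotient.\<close>

lemma quot_characters_iff:
  "\<phi> \<in> quot_characters cscale (p \<alpha>) \<longleftrightarrow>
     \<phi> \<in> extensional (quot (p \<alpha>)) \<and> is_character (gamma p \<alpha> \<phi>)"
  by (auto simp: quot_characters_def is_character_def gamma_def quot_def)

lemma gamma_kernel:
  assumes "\<phi> \<in> quot_characters cscale (p \<alpha>)" "p \<alpha> x = 0"
  shows "gamma p \<alpha> \<phi> x = 0"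
proof -
  have "quot_map (p \<alpha>) x = quot_map (p \<alpha>) (cscale 0 x)"
    using assms(2) by (intro quot_map_eqI[OF vector_space_axioms seminorm_p]) simp
  moreover have "gamma p \<alpha> \<phi> (cscale 0 x) = 0 * gamma p \<alpha> \<phi> x"
    using assms(1) unfolding quot_characters_iff is_character_def by blast
  ultimately show ?thesis by (simp add: gamma_def)
qed

lemma quot_character_bound:
  assumes "\<phi> \<in> quot_characters cscale (p \<alpha>)"
  shows "cmod (\<phi> (quot_map (p \<alpha>) a)) \<le> 4 * p \<alpha> a"
  using character_bound[of "gamma p \<alpha> \<phi>" \<alpha> a] assms gamma_kernel[OF assms]
  by (simp add: quot_characters_iff gamma_def)

lemma Hausdorff_quot_character_space: "Hausdorff_space (quot_character_space cscale (p \<alpha>))"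
  unfolding quot_character_space_def
  by (intro Hausdorff_space_subtopology) (simp add: Hausdorff_space_product_topology)

text \<open>As in the Banach-Alaoglu theorem: by \<open>quot_character_bound\<close> the characters
  lie in a product of closed discs, compact by Tychonoff, and they are cut out by closed
  conditions.\<close>

lemma compact_quot_character_space: "compact_space (quot_character_space cscale (p \<alpha>))"
proof -
  let ?Q = "quot_map (p \<alpha>)"
  let ?T = "product_topology (\<lambda>_. euclidean :: complex topology) (quot (p \<alpha>))"
  \<comment> \<open>The bound holds for every representative, so any choice of one may fix the
    radius at \<open>X\<close>.\<close>
  define K where "K = (\<Pi>\<^sub>E X\<in>quot (p \<alpha>). cball (0 :: complex) (4 * p \<alpha> (SOME a. X = ?Q a)))"
  have "compactin ?T K"
    unfolding K_def compactin_PiE by (simp add: compactin_euclidean_iff)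
  have proj: "continuous_map ?T euclidean (\<lambda>\<phi>. \<phi> (?Q a))" for a
    by (rule continuous_map_product_projection) simp
  have cmult: "continuous_map ?T euclidean (\<lambda>\<phi>. f \<phi> * g \<phi>)"
    if "continuous_map ?T euclidean f" "continuous_map ?T euclidean g" for f g :: "_ \<Rightarrow> complex"
    using that by (simp add: continuous_map_atin tendsto_mult)
  let ?F = "quot (p \<alpha>) \<rightarrow>\<^sub>E (UNIV :: complex set)"
  have closed: "closedin ?T {\<phi> \<in> ?F. f \<phi> = g \<phi>}"
    if "continuous_map ?T euclidean f" "continuous_map ?T euclidean g" for f g :: "_ \<Rightarrow> complex"
    using closedin_continuous_map_preimage[OF continuous_map_diff[OF that], of "{0}"] by simp
  \<comment> \<open>Being nonzero is not a closed condition; it is replaced by the equivalent value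
    1 at the unit coset.\<close>
  define conditions where "conditions =
    range (\<lambda>(a, b). {\<phi> \<in> ?F. \<phi> (?Q (a + b)) = \<phi> (?Q a) + \<phi> (?Q b)}) \<union>
    range (\<lambda>(c, a). {\<phi> \<in> ?F. \<phi> (?Q (cscale c a)) = c * \<phi> (?Q a)}) \<union>
    range (\<lambda>(a, b). {\<phi> \<in> ?F. \<phi> (?Q (a * b)) = \<phi> (?Q a) * \<phi> (?Q b)}) \<union>
    {{\<phi> \<in> ?F. \<phi> (?Q 1) = 1}}"
  have closed_conditions: "closedin ?T (\<Inter>conditions)"
  proof (rule closedin_Inter)
    show "closedin ?T S" if "S \<in> conditions" for S
      using that unfolding conditions_def
      by (auto intro!: closed continuous_map_add cmult proj)
  qed (simp add: conditions_def)
  have conditions_iff: "\<phi> \<in> \<Inter>conditions \<longleftrightarrow> \<phi> \<in> ?F \<and>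
      (\<forall>a b. \<phi> (?Q (a + b)) = \<phi> (?Q a) + \<phi> (?Q b)) \<and>
      (\<forall>c a. \<phi> (?Q (cscale c a)) = c * \<phi> (?Q a)) \<and>
      (\<forall>a b. \<phi> (?Q (a * b)) = \<phi> (?Q a) * \<phi> (?Q b)) \<and> \<phi> (?Q 1) = 1" for \<phi>
    unfolding conditions_def Inter_Un_distrib by (auto simp only: Int_iff INT_iff split_paired_All
        prod.case mem_Collect_eq Inter_iff singleton_iff UNIV_I ball_simps simp_thms)
  have "quot_characters cscale (p \<alpha>) = \<Inter>conditions \<inter> K"
  proof (intro equalityI subsetI)
    fix \<phi> assume \<phi>: "\<phi> \<in> quot_characters cscale (p \<alpha>)"
    then have ch: "is_character (gamma p \<alpha> \<phi>)" and ext: "\<phi> \<in> extensional (quot (p \<alpha>))"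
      by (auto simp: quot_characters_iff)
    have "\<phi> X \<in> cball 0 (4 * p \<alpha> (SOME a. X = ?Q a))" if "X \<in> quot (p \<alpha>)" for X
    proof -
      define b where "b = (SOME a. X = ?Q a)"
      have "\<exists>a. X = ?Q a" using that by (auto simp: quot_def)
      then have "X = ?Q b" unfolding b_def by (rule someI_ex)
      then show ?thesis
        unfolding b_def[symmetric] using quot_character_bound[OF \<phi>, of b] by simp
    qed
    then have "\<phi> \<in> K" using ext by (simp add: K_def PiE_def)
    moreover have "\<phi> \<in> \<Inter>conditions"
      using ch ext character_one[OF ch]
      unfolding conditions_iff by (simp add: is_character_def gamma_def PiE_def)
    ultimately show "\<phi> \<in> \<Inter>conditions \<inter> K" by blast
  next
    fix \<phi> assume "\<phi> \<in> \<Inter>conditions \<inter> K"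
    then have "\<phi> \<in> \<Inter>conditions" by blast
    moreover from this have "\<exists>a. \<phi> (?Q a) \<noteq> 0"
      unfolding conditions_iff by (intro exI[of _ 1]) simp
    ultimately show "\<phi> \<in> quot_characters cscale (p \<alpha>)"
      unfolding conditions_iff by (simp add: quot_characters_iff is_character_def gamma_def PiE_def)
  qed
  then show ?thesis
    unfolding quot_character_space_def using closed_conditions \<open>compactin ?T K\<close>
    by (simp add: compact_space_subtopology closed_Int_compactin)
qed

section \<open>The inductive system and its limit\<close>

lemma conn_map_p [simp]: "\<alpha> \<le> \<beta> \<Longrightarrow> conn_map (p \<alpha>) (quot_map (p \<beta>) a) = quot_map (p \<alpha>) a"
  using upward_filtered by (intro conn_map_quot_map[OF vector_space_axioms seminorm_p seminorm_p])

text \<open>With \<open>inj_on_gamma\<close>, this reduces identities between connecting maps to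
  identities between functionals on the algebra.\<close>

lemma gamma_gamma_conn: "\<alpha> \<le> \<beta> \<Longrightarrow> gamma p \<beta> (gamma_conn p \<beta> \<alpha> \<phi>) = gamma p \<alpha> \<phi>"
  by (auto simp: gamma_def gamma_conn_def)

lemma gamma_conn_in_quot_characters:
  "\<alpha> \<le> \<beta> \<Longrightarrow> \<phi> \<in> quot_characters cscale (p \<alpha>) \<Longrightarrow>
    gamma_conn p \<beta> \<alpha> \<phi> \<in> quot_characters cscale (p \<beta>)"
  by (simp add: quot_characters_iff gamma_gamma_conn) (simp add: gamma_conn_def)

text \<open>Continuity is tested on evaluations, and evaluating the image at the \<beta>-coset of a
  is evaluating the argument at the \<alpha>-coset of a.\<close>

lemma continuous_gamma_conn:
  assumes "\<alpha> \<le> \<beta>"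
  shows "continuous_map (quot_character_space cscale (p \<alpha>)) (quot_character_space cscale (p \<beta>))
    (gamma_conn p \<beta> \<alpha>)"
proof -
  have "continuous_map (quot_character_space cscale (p \<alpha>)) euclidean (\<lambda>\<phi>. gamma_conn p \<beta> \<alpha> \<phi> X)"
    if "X \<in> quot (p \<beta>)" for X
  proof -
    from that obtain a where "X = quot_map (p \<beta>) a" by (auto simp: quot_def)
    then have "(\<lambda>\<phi>. gamma_conn p \<beta> \<alpha> \<phi> X) = (\<lambda>\<phi>. \<phi> (quot_map (p \<alpha>) a))"
      using assms by (auto simp: gamma_conn_def)
    then show ?thesis
      using continuous_map_product_projection[of "quot_map (p \<alpha>) a" "quot (p \<alpha>)" "\<lambda>_. euclidean"]
      unfolding quot_character_space_def by (intro continuous_map_from_subtopology) simp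
  qed
  moreover have "gamma_conn p \<beta> \<alpha> ` quot_characters cscale (p \<alpha>) \<subseteq> extensional (quot (p \<beta>))"
    by (auto simp: gamma_conn_def)
  ultimately show ?thesis
    unfolding quot_character_space_def[of cscale "p \<beta>"]
    by (simp add: continuous_map_in_subtopology continuous_map_componentwise
        topspace_quot_character_space gamma_conn_in_quot_characters[OF assms])
qed

lemma inductive_system_quot_character_space:
  "inductive_system (\<lambda>\<alpha>. quot_character_space cscale (p \<alpha>)) (gamma_conn p)"
  unfolding inductive_system_def topspace_quot_character_space
proof (intro conjI allI impI ballI)
  fix \<alpha> \<beta> \<delta> :: 'i and \<phi> assume \<phi>: "\<phi> \<in> quot_characters cscale (p \<alpha>)"
  note in_characters = gamma_conn_in_quot_characters
  show "gamma_conn p \<alpha> \<alpha> \<phi> = \<phi>"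
    using \<phi> by (intro inj_onD[OF inj_on_gamma[of p \<alpha> cscale]]) (simp_all add: gamma_gamma_conn in_characters)
  assume "\<alpha> \<le> \<beta>" "\<beta> \<le> \<delta>"
  moreover from this have "\<alpha> \<le> \<delta>" by (rule order_trans)
  ultimately show "gamma_conn p \<delta> \<beta> (gamma_conn p \<beta> \<alpha> \<phi>) = gamma_conn p \<delta> \<alpha> \<phi>"
    using \<phi> by (intro inj_onD[OF inj_on_gamma[of p \<delta> cscale]]) (simp_all add: gamma_gamma_conn in_characters)
qed (rule continuous_gamma_conn)

text \<open>By injectivity, the preimage of an open \<open>S\<close> is the very open set
  \<open>W\<close> whose image is the trace of \<open>S\<close> on \<open>Z_set\<close>.\<close>

lemma continuous_gamma:
  "continuous_map (quot_character_space cscale (p \<alpha>)) (character_space cscale p) (gamma p \<alpha>)"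
  unfolding continuous_map_def topspace_quot_character_space topspace_character_space
proof (intro conjI allI impI)
  show "gamma p \<alpha> \<in> quot_characters cscale (p \<alpha>) \<rightarrow> characters cscale p"
    by (auto simp: characters_def Z_set_def)
  fix S assume "openin (character_space cscale p) S"
  then obtain W where W: "openin (quot_character_space cscale (p \<alpha>)) W"
    "S \<inter> Z_set cscale p \<alpha> = gamma p \<alpha> ` W"
    unfolding openin_character_space openin_Z_space by blast
  have "W \<subseteq> quot_characters cscale (p \<alpha>)"
    using openin_subset[OF W(1)] by (simp add: topspace_quot_character_space)
  then have "{\<phi> \<in> quot_characters cscale (p \<alpha>). gamma p \<alpha> \<phi> \<in> S} = W"
    using W(2) inj_on_gamma[of p \<alpha> cscale] unfolding Z_set_def inj_on_def by blast
  then show "openin (quot_character_space cscale (p \<alpha>))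
      {\<phi> \<in> quot_characters cscale (p \<alpha>). gamma p \<alpha> \<phi> \<in> S}"
    using W(1) by simp
qed

text \<open>Directedness supplies a common upper bound \<delta>, at which injectivity of
  \<open>gamma\<close> identifies the images of the two characters; compatibility carries this back.
  It makes the mediating map well defined.\<close>

lemma compatible_pair_eq:
  assumes "compatible_pair (\<lambda>\<alpha>. quot_character_space cscale (p \<alpha>)) (gamma_conn p) Y \<kappa>"
    and "\<phi> \<in> quot_characters cscale (p \<alpha>)" "\<psi> \<in> quot_characters cscale (p \<beta>)"
    and "gamma p \<alpha> \<phi> = gamma p \<beta> \<psi>"
  shows "\<kappa> \<alpha> \<phi> = \<kappa> \<beta> \<psi>"
proof -
  obtain \<delta> where \<delta>: "\<alpha> \<le> \<delta>" "\<beta> \<le> \<delta>" using directed by blast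
  have "gamma_conn p \<delta> \<alpha> \<phi> = gamma_conn p \<delta> \<beta> \<psi>"
    using assms(2-) \<delta>
    by (intro inj_onD[OF inj_on_gamma[of p \<delta> cscale]])
      (simp_all add: gamma_gamma_conn gamma_conn_in_quot_characters)
  then show ?thesis
    using assms(1-3) \<delta> unfolding compatible_pair_def topspace_quot_character_space by metis
qed

text \<open>The topology is final for the maps \<open>gamma p \<alpha>\<close>: the trace of a
  preimage on each \<open>Z_set\<close> is the image of an open set of quotient characters.\<close>

lemma continuous_map_from_character_space:
  assumes "\<And>\<alpha>. continuous_map (quot_character_space cscale (p \<alpha>)) Y (k \<circ> gamma p \<alpha>)"
  shows "continuous_map (character_space cscale p) Y k"
  unfolding continuous_map_def topspace_character_space
proof (intro conjI allI impI)
  show "k \<in> characters cscale p \<rightarrow> topspace Y"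
    using continuous_map_funspace[OF assms]
    by (force simp: topspace_quot_character_space characters_def Z_set_def Pi_iff)
  fix V assume V: "openin Y V"
  have "openin (Z_space cscale p \<alpha>) ({f \<in> characters cscale p. k f \<in> V} \<inter> Z_set cscale p \<alpha>)" for \<alpha>
    unfolding openin_Z_space
  proof (intro exI conjI)
    show "openin (quot_character_space cscale (p \<alpha>))
        {\<phi> \<in> quot_characters cscale (p \<alpha>). (k \<circ> gamma p \<alpha>) \<phi> \<in> V}"
      using openin_continuous_map_preimage[OF assms V] by (simp add: topspace_quot_character_space)
    show "{f \<in> characters cscale p. k f \<in> V} \<inter> Z_set cscale p \<alpha> =
        gamma p \<alpha> ` {\<phi> \<in> quot_characters cscale (p \<alpha>). (k \<circ> gamma p \<alpha>) \<phi> \<in> V}"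
      by (auto simp: characters_def Z_set_def)
  qed
  then show "openin (character_space cscale p) {f \<in> characters cscale p. k f \<in> V}"
    by (auto simp: openin_character_space)
qed

lemma inductive_limit_character_space:
  "inductive_limit TYPE('y) (\<lambda>\<alpha>. quot_character_space cscale (p \<alpha>)) (gamma_conn p)
     (character_space cscale p) (gamma p)"
  unfolding inductive_limit_def
proof (intro conjI allI impI)
  show "compatible_pair (\<lambda>\<alpha>. quot_character_space cscale (p \<alpha>)) (gamma_conn p)
      (character_space cscale p) (gamma p)"
    by (simp add: compatible_pair_def continuous_gamma gamma_gamma_conn)
  fix Y :: "'y topology" and \<kappa>
  assume comp: "compatible_pair (\<lambda>\<alpha>. quot_character_space cscale (p \<alpha>)) (gamma_conn p) Y \<kappa>"
  \<comment> \<open>Each character is some \<open>gamma p \<alpha> \<phi>\<close>, and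
    \<open>compatible_pair_eq\<close> makes the value independent of that choice, which justifies
    \<open>THE\<close>.\<close>
  define k where "k = restrict (\<lambda>f. THE v. \<exists>\<alpha>. \<exists>\<phi>\<in>quot_characters cscale (p \<alpha>).
      gamma p \<alpha> \<phi> = f \<and> v = \<kappa> \<alpha> \<phi>) (characters cscale p)"
  have k: "k (gamma p \<alpha> \<phi>) = \<kappa> \<alpha> \<phi>" if "\<phi> \<in> quot_characters cscale (p \<alpha>)" for \<alpha> \<phi>
  proof -
    have "gamma p \<alpha> \<phi> \<in> characters cscale p" using that by (auto simp: characters_def Z_set_def)
    then show ?thesis
      unfolding k_def restrict_apply
      by (auto intro!: the_equality that intro: compatible_pair_eq[OF comp _ that])
  qed
  have cont: "continuous_map (character_space cscale p) Y k"
  proof (rule continuous_map_from_character_space)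
    show "continuous_map (quot_character_space cscale (p \<alpha>)) Y (k \<circ> gamma p \<alpha>)" for \<alpha>
      using comp k by (auto simp: compatible_pair_def topspace_quot_character_space
          intro: continuous_map_eq)
  qed
  show "\<exists>!k. k \<in> extensional (topspace (character_space cscale p)) \<and>
      continuous_map (character_space cscale p) Y k \<and>
      (\<forall>\<alpha>. \<forall>\<phi>\<in>topspace (quot_character_space cscale (p \<alpha>)). k (gamma p \<alpha> \<phi>) = \<kappa> \<alpha> \<phi>)"
    unfolding topspace_character_space topspace_quot_character_space
  proof (rule ex1I[of _ k])
    show "k \<in> extensional (characters cscale p) \<and> continuous_map (character_space cscale p) Y k \<and>
        (\<forall>\<alpha>. \<forall>\<phi>\<in>quot_characters cscale (p \<alpha>). k (gamma p \<alpha> \<phi>) = \<kappa> \<alpha> \<phi>)"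
      using k cont by (simp add: k_def)
    \<comment> \<open>The images of the maps \<open>gamma p \<alpha>\<close> cover the character
      space, and both maps are \<open>undefined\<close> off it.\<close>
    show "k' = k" if "k' \<in> extensional (characters cscale p) \<and>
        continuous_map (character_space cscale p) Y k' \<and>
        (\<forall>\<alpha>. \<forall>\<phi>\<in>quot_characters cscale (p \<alpha>). k' (gamma p \<alpha> \<phi>) = \<kappa> \<alpha> \<phi>)" for k'
    proof (rule extensionalityI[of _ "characters cscale p"])
      show "k \<in> extensional (characters cscale p)" by (simp add: k_def)
    qed (use that k in \<open>auto simp: characters_def Z_set_def\<close>)
  qed
qed

end

theorem mainTheorem1:
  fixes cscale :: "complex \<Rightarrow> 'a::comm_ring_1 \<Rightarrow> 'a"
    and star :: "'a \<Rightarrow> 'a"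
    and p :: "'i::order \<Rightarrow> 'a \<Rightarrow> real"
  assumes "locally_cstar_algebra cscale star p"
  shows "(\<forall>\<alpha>. compact_space (quot_character_space cscale (p \<alpha>)) \<and>
              Hausdorff_space (quot_character_space cscale (p \<alpha>))) \<and>
         inductive_system (\<lambda>\<alpha>. quot_character_space cscale (p \<alpha>)) (gamma_conn p) \<and>
         inductive_limit TYPE('y) (\<lambda>\<alpha>. quot_character_space cscale (p \<alpha>)) (gamma_conn p)
           (character_space cscale p) (gamma p)"
proof -
  interpret commutative_locally_cstar_algebra cscale star p
    by (rule commutative_locally_cstar_algebra.intro) (rule assms)
  show ?thesis
    using compact_quot_character_space Hausdorff_quot_character_space
      inductive_system_quot_character_space inductive_limit_character_space by blast
qed

end
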